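(* (A) Let $K$ be a real quadratic field with associated rank grid $r_{j,m}$ and dimension grid $d_{j,m}$. Then for all positive integers $j,m$: (1) $0<r_{j,m}<\frac{d_{j,m}-1}{2}$; and (2) $(d_j+1)\,r_{j,m}\,(d_{j,m}-r_{j,m})=d_{j,m}^2-1$. (B) Conversely, let $r,d$ be integers such that $0<r<\frac{d-1}{2}$ and $nr(d-r)=d^2-1$ for some integer $n>4$. Then there exist a unique real quadratic field $K$ and unique positive integers $j,m$ such that $r=r_{j,m}$, $d=d_{j,m}$ and $n=d_j+1$, where $r_{j,m}$, $d_{j,m}$, $d_j$ are the grids associated to $K$.
   Context: Let $K\subset\mathbb{R}$ be a real quadratic field of discriminant $\Delta_0$, and let $\varepsilon$ be the smallest unit of $K$ of norm $+1$ that is greater than $1$. For positive integers $j$ set $f_j=(\varepsilon^j-\varepsilon^{-j})/\sqrt{\Delta_0}$. For positive integers $j,m$ define the rank grid $r_{j,m}=f_{jm}/f_j$, the dimension grid $d_{j,m}=r_{j,m+1}+r_{j,m}$, and $d_j=d_{j,1}$. *)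

theory Defs
  imports Complex_Main "HOL-Library.FuncSet" "HOL-Computational_Algebra.Polynomial"
begin

definition real_subfield :: "real set \<Rightarrow> bool" where
  "real_subfield K \<longleftrightarrow>
     0 \<in> K \<and> 1 \<in> K \<and>
     (\<forall>x\<in>K. \<forall>y\<in>K. x + y \<in> K \<and> x * y \<in> K) \<and>
     (\<forall>x\<in>K. - x \<in> K \<and> inverse x \<in> K)"

lemma vector_space_rat_real: "vector_space (\<lambda>(q::rat) (x::real). of_rat q * x)"
  by unfold_locales (simp_all add: algebra_simps of_rat_add of_rat_mult)

text \<open>Dimension 2 excludes infinite dimension, for which \<open>dim\<close> is 0.\<close>

definition real_quadratic_field :: "real set \<Rightarrow> bool" where
  "real_quadratic_field K \<longleftrightarrow>
     real_subfield K \<and> vector_space.dim (\<lambda>(q::rat) (x::real). of_rat q * x) K = 2"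

definition ring_of_integers :: "real set \<Rightarrow> real set" where
  "ring_of_integers K = {x \<in> K. algebraic_int x}"

definition unit_group :: "real set \<Rightarrow> real set" where
  "unit_group K = {u \<in> ring_of_integers K. \<exists>v\<in>ring_of_integers K. u * v = 1}"

text \<open>Automorphisms are taken to be \<open>undefined\<close> outside \<open>K\<close>, so that each is counted once.\<close>

definition field_auts :: "real set \<Rightarrow> (real \<Rightarrow> real) set" where
  "field_auts K = {\<sigma> \<in> extensional K. bij_betw \<sigma> K K \<and> \<sigma> 1 = 1 \<and>
     (\<forall>x\<in>K. \<forall>y\<in>K. \<sigma> (x + y) = \<sigma> x + \<sigma> y \<and> \<sigma> (x * y) = \<sigma> x * \<sigma> y)}"

text \<open>
  Norm and trace to the rationals; the product and sum over automorphisms are the right ones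
  because a quadratic field is Galois over the rationals.
\<close>

definition field_norm :: "real set \<Rightarrow> real \<Rightarrow> real" where
  "field_norm K x = (\<Prod>\<sigma>\<in>field_auts K. \<sigma> x)"

definition field_trace :: "real set \<Rightarrow> real \<Rightarrow> real" where
  "field_trace K x = (\<Sum>\<sigma>\<in>field_auts K. \<sigma> x)"

definition integral_basis :: "real set \<Rightarrow> real \<Rightarrow> real \<Rightarrow> bool" where
  "integral_basis K w1 w2 \<longleftrightarrow>
     bij_betw (\<lambda>(a::int, b::int). of_int a * w1 + of_int b * w2) UNIV (ring_of_integers K)"

text \<open>
  The discriminant is the determinant of the trace form on an integral basis; it does not depend
  on the basis.
\<close>

definition field_disc :: "real set \<Rightarrow> real" where
  "field_disc K = (THE D. \<exists>w1 w2. integral_basis K w1 w2 \<and>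
     D = field_trace K (w1 * w1) * field_trace K (w2 * w2) - (field_trace K (w1 * w2))\<^sup>2)"

definition norm_one_unit :: "real set \<Rightarrow> real" where
  "norm_one_unit K = (LEAST u. u \<in> unit_group K \<and> field_norm K u = 1 \<and> u > 1)"

definition f_seq :: "real set \<Rightarrow> nat \<Rightarrow> real" where
  "f_seq K j = (norm_one_unit K ^ j - inverse (norm_one_unit K ^ j)) / sqrt (field_disc K)"

definition rank_grid :: "real set \<Rightarrow> nat \<Rightarrow> nat \<Rightarrow> real" where
  "rank_grid K j m = f_seq K (j * m) / f_seq K j"

definition dim_grid :: "real set \<Rightarrow> nat \<Rightarrow> nat \<Rightarrow> real" where
  "dim_grid K j m = rank_grid K j (m + 1) + rank_grid K j m"

definition dim_seq :: "real set \<Rightarrow> nat \<Rightarrow> real" where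
  "dim_seq K j = dim_grid K j 1"

end

theory Submission
  imports Defs "HOL-Analysis.Kronecker_Approximation_Theorem"
begin

text \<open>
  With \<open>x = \<epsilon>\<^sup>j > 1\<close> and \<open>t = x + 1/x\<close>, the rank grid is the Lucas sequence \<open>R 0 = 0\<close>, \<open>R 1 = 1\<close>,
  \<open>R (m + 2) = t R (m + 1) - R m\<close>, and \<open>d\<^sub>j + 1 = t + 2\<close>. The quadratic form \<open>u\<^sup>2 + r\<^sup>2 - t r u\<close> is
  constantly 1 along consecutive terms, which is identity (2), and the differences grow, which is (1).
  Conversely, with \<open>t = n - 2\<close> and \<open>u = d - r\<close> the equation says that \<open>(r, u)\<close> lies on this conic, and
  the descent \<open>(r, u) \<mapsto> (t r - u, r)\<close> ends at \<open>(0, 1)\<close>. The root \<open>x > 1\<close> of \<open>x + 1/x = t\<close> is a unit of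
  norm 1, hence a power of the fundamental one, and it generates its field, which gives uniqueness.

  What remains is that the discriminant is well defined and nonzero, so that it cancels in the
  quotient, and that \<open>\<epsilon>\<close> exists, which is Pell's equation.
\<close>

text \<open>The difference of the sides is \<open>(y - x) * (1 - inverse (x * y))\<close>. Thus
  units above 1 are ordered by their traces, and a trace determines its unit.\<close>

lemma add_inverse_strict_mono:
  fixes x y :: real
  assumes "1 < x" "x < y"
  shows "x + inverse x < y + inverse y"
proof -
  have "0 < (y - x) * (1 - inverse (x * y))"
    using assms less_1_mult[of x y] by (intro mult_pos_pos) (auto simp: inverse_less_1_iff simp del: inverse_mult_distrib)
  then show ?thesis using assms by (simp add: field_simps)
qed

lemma irrational_linear_eq_0:
  fixes x a b :: real
  assumes "x \<notin> \<rat>" "a \<in> \<rat>" "b \<in> \<rat>" "a + b * x = 0"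
  shows "a = 0 \<and> b = 0"
proof -
  have "b = 0"
  proof (rule ccontr)
    assume "b \<noteq> 0"
    with assms(4) have "x = - a / b" by (simp add: field_simps)
    with assms show False by auto
  qed
  with assms show ?thesis by auto
qed

subsection \<open>Quadratic algebraic integers\<close>

lemma algebraic_int_monic_quadratic:
  fixes x t n :: real
  assumes "t \<in> \<int>" "n \<in> \<int>" "x\<^sup>2 = t * x - n"
  shows "algebraic_int x"
proof
  show "lead_coeff [:n, -t, 1:] = 1" by simp
  show "\<forall>i. coeff [:n, -t, 1:] i \<in> \<int>"
    using assms by (auto simp: coeff_pCons split: nat.splits)
  show "poly [:n, -t, 1:] x = 0"
    using assms(3) by (simp add: algebra_simps power2_eq_square)
qed

lemma poly_of_int_add:
  "poly (map_poly of_int (f + g)) x = poly (map_poly of_int f) x + poly (map_poly of_int g) (x :: real)"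
proof -
  have "map_poly of_int (f + g) = map_poly of_int f + (map_poly of_int g :: real poly)"
    by (rule poly_eqI) (simp add: coeff_map_poly)
  then show ?thesis by simp
qed

lemma poly_of_int_smult:
  "poly (map_poly of_int (smult c f)) x = of_int c * poly (map_poly of_int f) (x :: real)"
proof -
  have "map_poly of_int (smult c f) = smult (of_int c) (map_poly of_int f :: real poly)"
    by (rule poly_eqI) (simp add: coeff_map_poly)
  then show ?thesis by simp
qed

lemma poly_of_int_mult:
  "poly (map_poly of_int (f * g)) x = poly (map_poly of_int f) x * poly (map_poly of_int g) (x :: real)"
  by (induction f)
     (simp_all add: poly_of_int_add poly_of_int_smult map_poly_pCons algebra_simps)

text \<open>Gauss's lemma: pseudo-division gives \<open>A\<^sup>k p = q u\<close>, and \<open>content u = A\<^sup>k\<close> divides the leading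
  coefficient of \<open>u\<close>, which is \<open>A\<^sup>k / A\<close>.\<close>

lemma primitive_quadratic_lead_coeff_eq_1:
  fixes x :: real and A B C :: int and p :: "int poly"
  assumes irr: "x \<notin> \<rat>" and p: "lead_coeff p = 1" "poly (map_poly of_int p) x = 0"
    and A: "A > 0" and cont: "Polynomial.content [:C, B, A:] = 1"
    and q: "of_int A * x\<^sup>2 + of_int B * x + of_int C = 0"
  shows "A = 1"
proof -
  define q where "q = [:C, B, A:]"
  have q0: "q \<noteq> 0" and lq: "lead_coeff q = A" and dq: "degree q = 2" and cq: "coeff q 2 = A"
    using A by (auto simp: q_def numeral_2_eq_2)
  obtain u r where ur: "pseudo_divmod p q = (u, r)" by force
  define k where "k = Suc (degree p) - degree q"
  from pseudo_divmod[OF q0 ur] have eq: "smult (A ^ k) p = q * u + r"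
    and r: "r = 0 \<or> degree r < 2" by (auto simp: cq dq k_def)
  \<comment> \<open>Evaluation at \<open>x\<close> kills both \<open>p\<close> and \<open>q\<close>,
    so a remainder of degree at most 1 with integer coefficients vanishes at an irrational
    number.\<close>
  have "r = 0"
  proof -
    obtain a b where ab: "r = [:a, b:]"
      using r by (cases r rule: pCons_cases, cases "degree r = 0") (auto elim!: degree_eq_zeroE split: if_splits)
    have "of_int (A ^ k) * poly (map_poly of_int p) x = poly (map_poly of_int q) x * poly (map_poly of_int u) x
            + poly (map_poly of_int r) x"
      by (metis eq poly_of_int_add poly_of_int_mult poly_of_int_smult)
    moreover have "poly (map_poly of_int q) x = 0"
      using q by (simp add: q_def map_poly_pCons algebra_simps power2_eq_square)
    ultimately have "of_int a + of_int b * x = 0"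
      using p by (simp add: ab map_poly_pCons algebra_simps)
    then show ?thesis
      using irrational_linear_eq_0[OF irr] ab by (metis Rats_of_int of_int_eq_0_iff pCons_0_0)
  qed
  then have eq: "smult (A ^ k) p = q * u" using eq by simp
  have "Polynomial.content p = 1"
    by (metis content_dvd_coeff p(1) normalize_content is_unit_normalize)
  then have "Polynomial.content u = A ^ k"
    using arg_cong[OF eq, of Polynomial.content] cont[folded q_def] A by (simp add: content_mult)
  then have "A ^ k dvd lead_coeff u" by (metis content_dvd_coeff)
  moreover have "A ^ k = A * lead_coeff u"
    using arg_cong[OF eq, of lead_coeff] p(1) lq A by (simp add: lead_coeff_mult)
  \<comment> \<open>Multiply \<open>A ^ k dvd lead_coeff u\<close> by \<open>A\<close> and use
    \<open>A * lead_coeff u = A ^ k\<close>.\<close>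
  ultimately have "A * A ^ k dvd A ^ k"
    by (metis mult_dvd_mono dvd_refl)
  then have "A dvd 1" using A by (metis dvd_mult_cancel_right mult_1 power_not_zero less_irrefl)
  then show ?thesis using A by simp
qed


text \<open>Clearing denominators and dividing by the content \<open>g\<close> gives a primitive
  integer quadratic with root \<open>x\<close>. Gauss's lemma makes its leading coefficient 1, so
  its other coefficients are \<open>-t\<close> and \<open>n\<close>.\<close>

lemma algebraic_int_quadratic_coeffs:
  fixes x t n :: real
  assumes irr: "x \<notin> \<rat>" and ai: "algebraic_int x" and t: "t \<in> \<rat>" and n: "n \<in> \<rat>" and eq: "x\<^sup>2 = t * x - n"
  shows "t \<in> \<int> \<and> n \<in> \<int>"
proof -
  obtain p where p: "lead_coeff p = (1::int)" "poly (map_poly of_int p) x = 0"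
    using ai by (auto simp: algebraic_int_altdef_ipoly)
  obtain a b where ab: "t = of_int a / of_int b" "b > 0" using t by (auto elim!: Rats_cases')
  obtain c d where cd: "n = of_int c / of_int d" "d > 0" using n by (auto elim!: Rats_cases')
  define g where "g = Polynomial.content [:c * b, - (a * d), b * d:]"
  have g: "g > 0" "g dvd c * b" "g dvd a * d" "g dvd b * d"
  proof -
    have *: "g dvd coeff [:c * b, - (a * d), b * d:] i" for i
      unfolding g_def by (rule content_dvd_coeff)
    show "g dvd c * b" "g dvd a * d" "g dvd b * d"
      using *[of 0] *[of 1] *[of 2] by (simp_all add: numeral_2_eq_2)
    have "g \<noteq> 0" using ab cd by (simp add: g_def)
    moreover have "\<bar>g\<bar> = g" unfolding g_def by (metis normalize_content normalize_int_def)
    ultimately show "g > 0" by linarith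
  qed
  obtain C B A where C: "c * b = g * C" and B: "a * d = g * B" and A: "b * d = g * A"
    using g by (elim dvdE) blast
  have "A > 0" using A ab cd g by (metis mult_pos_pos zero_less_mult_pos)
  have "Polynomial.content [:C, - B, A:] = 1"
  proof -
    have "[:c * b, - (a * d), b * d:] = smult g [:C, - B, A:]"
      by (simp add: A B C)
    then have "g = g * Polynomial.content [:C, - B, A:]"
      using g_def g(1) by (metis content_smult abs_of_pos normalize_int_def)
    then show ?thesis using g(1) by simp
  qed
  have tB: "of_int A * t = of_int B"
  proof -
    have "of_int g * (of_int A * t) = of_int (b * d) * t" by (simp add: A)
    also have "\<dots> = of_int (a * d)" using ab by simp
    also have "\<dots> = of_int g * of_int B" by (simp add: B)
    finally show ?thesis using g(1) by simp
  qed
  have nC: "of_int A * n = of_int C"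
  proof -
    have "of_int g * (of_int A * n) = of_int (b * d) * n" by (simp add: A)
    also have "\<dots> = of_int (c * b)" using cd by simp
    also have "\<dots> = of_int g * of_int C" by (simp add: C)
    finally show ?thesis using g(1) by simp
  qed
  have "A = 1"
  proof (rule primitive_quadratic_lead_coeff_eq_1[OF irr p \<open>A > 0\<close> \<open>Polynomial.content [:C, - B, A:] = 1\<close>])
    have "of_int A * x\<^sup>2 = of_int B * x - of_int C"
      unfolding eq tB[symmetric] nC[symmetric] by (simp add: algebra_simps)
    then show "of_int A * x\<^sup>2 + of_int (- B) * x + of_int C = 0" by simp
  qed
  with tB nC show ?thesis by (auto simp: Ints_def)
qed

subsection \<open>Pell's equation\<close>

text \<open>With \<open>e = h - k * sqrt D\<close> the norm is
  \<open>e * (e + 2 * k * sqrt D)\<close>, and \<open>\<bar>e\<bar> < 1 / k\<close> absorbs the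
  factor \<open>k\<close>. The bound is the same for all good approximations, which is what the
  pigeonhole argument for Pell's equation needs.\<close>

lemma approx_set_norm_bound:
  assumes "(h, k) \<in> approx_set (sqrt (real D))"
  shows "\<bar>h\<^sup>2 - int D * k\<^sup>2\<bar> \<le> \<lceil>2 * sqrt (real D) + 1\<rceil>"
proof -
  let ?s = "sqrt (real D)"
  have k: "k > 0" and a: "\<bar>?s - of_int h / of_int k\<bar> < 1 / (of_int k)\<^sup>2"
    using assms by (auto simp: approx_set_def)
  define e where "e = of_int h - of_int k * ?s"
  have "\<bar>e\<bar> = of_int k * \<bar>?s - of_int h / of_int k\<bar>"
    using k by (simp add: e_def abs_mult_pos' right_diff_distrib abs_minus_commute flip: abs_mult_pos)
  also have "\<dots> < of_int k * (1 / (of_int k)\<^sup>2)"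
    using a k by (intro mult_strict_left_mono) auto
  also have "\<dots> = 1 / of_int k" using k by (simp add: power2_eq_square)
  finally have e: "\<bar>e\<bar> < 1 / of_int k" .
  have k1: "1 / of_int k \<le> (1::real)" using k by simp
  have "real_of_int \<bar>h\<^sup>2 - int D * k\<^sup>2\<bar> = \<bar>e * (e + 2 * of_int k * ?s)\<bar>"
    by (simp add: e_def algebra_simps power2_eq_square)
  also have "\<dots> \<le> \<bar>e\<bar> * (\<bar>e\<bar> + 2 * of_int k * ?s)"
  proof -
    have "0 \<le> 2 * of_int k * ?s" using k by simp
    then have "\<bar>e + 2 * of_int k * ?s\<bar> \<le> \<bar>e\<bar> + 2 * of_int k * ?s" by linarith
    then show ?thesis unfolding abs_mult by (intro mult_left_mono) auto
  qed
  also have "\<dots> \<le> (1 / of_int k) * (1 + 2 * of_int k * ?s)"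
  proof (rule mult_mono)
    show "\<bar>e\<bar> \<le> 1 / of_int k" using e by simp
    show "\<bar>e\<bar> + 2 * of_int k * ?s \<le> 1 + 2 * of_int k * ?s" using e k1 by linarith
  qed (use k in auto)
  also have "\<dots> \<le> 2 * ?s + 1"
    using k k1 by (simp add: field_simps)
  finally show ?thesis by linarith
qed

text \<open>Two good approximations \<open>h/k\<close> and \<open>h'/k'\<close> with the same norm \<open>N\<close> and congruent modulo \<open>N\<close> have an
  integral quotient of norm 1.\<close>

lemma Pell_solution_exists:
  assumes irr: "sqrt (real D) \<notin> \<rat>"
  obtains x y :: int where "x\<^sup>2 - int D * y\<^sup>2 = 1" "x > 0" "y > 0"
proof -
  let ?s = "sqrt (real D)"
  define M where "M = \<lceil>2 * ?s + 1\<rceil>"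
  \<comment> \<open>A collision of \<open>f\<close> is a pair of approximations with the same norm
    and the same residues modulo it. The values of \<open>f\<close> lie in a bounded box and
    \<open>approx_set\<close> is infinite, so a collision exists.\<close>
  define f where "f = (\<lambda>(h, k). let N = h\<^sup>2 - int D * k\<^sup>2 in (N, h mod N, k mod N))"
  have norm0: "h\<^sup>2 - int D * k\<^sup>2 \<noteq> 0" if "k > 0" for h k :: int
  proof
    assume "h\<^sup>2 - int D * k\<^sup>2 = 0"
    then have "real_of_int (h\<^sup>2) = real_of_int (int D * k\<^sup>2)" by simp
    then have "real D = (of_int h / of_int k)\<^sup>2"
      using that by (simp add: field_simps)
    then have "?s = \<bar>of_int h / of_int k\<bar>" by simp
    moreover have "\<bar>of_int h / of_int k\<bar> \<in> (\<rat> :: real set)" by (auto simp: Rats_abs_iff)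
    ultimately show False using irr by simp
  qed
  have "f ` approx_set ?s \<subseteq> {-M..M} \<times> {-M..M} \<times> {-M..M}"
  proof
    fix z assume "z \<in> f ` approx_set ?s"
    then obtain h k where hk: "(h, k) \<in> approx_set ?s" and z: "z = f (h, k)" by auto
    define N where "N = h\<^sup>2 - int D * k\<^sup>2"
    have k: "k > 0" using hk by (auto simp: approx_set_def)
    have N0: "N \<noteq> 0" using norm0[OF k] by (simp add: N_def)
    have NM: "\<bar>N\<bar> \<le> M" using approx_set_norm_bound[OF hk] by (simp add: M_def N_def)
    have "\<bar>a mod N\<bar> \<le> M" for a :: int
      using abs_mod_less[OF N0, of a] NM by linarith
    from this[of h] this[of k] NM show "z \<in> {-M..M} \<times> {-M..M} \<times> {-M..M}"
      by (auto simp: z f_def N_def[symmetric] Let_def abs_le_iff)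
  qed
  then have "finite (f ` approx_set ?s)" by (rule finite_subset) auto
  moreover have "infinite (approx_set ?s)"
    using irr rational_iff_finite_approx_set by blast
  ultimately have "\<not> inj_on f (approx_set ?s)" using finite_imageD by blast
  then obtain h k h' k' where hk: "(h, k) \<in> approx_set ?s" and hk': "(h', k') \<in> approx_set ?s"
    and ne: "(h, k) \<noteq> (h', k')" and feq: "f (h, k) = f (h', k')"
    unfolding inj_on_def by (metis surj_pair)
  have k: "k > 0" "k' > 0" "coprime h k" "coprime h' k'"
    using hk hk' by (auto simp: approx_set_def)
  define N where "N = h\<^sup>2 - int D * k\<^sup>2"
  have N': "N = h'\<^sup>2 - int D * k'\<^sup>2" and hm: "h mod N = h' mod N" and km: "k mod N = k' mod N"
    using feq by (auto simp: f_def Let_def N_def)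
  have N0: "N \<noteq> 0" using norm0[OF k(1)] by (simp add: N_def)
  obtain a where a: "h' = h + N * a" using hm by (metis mod_eqE)
  obtain b where b: "k' = k + N * b" using km by (metis mod_eqE)
  \<comment> \<open>The solution is
    \<open>x + y * sqrt D = (h + k * sqrt D) * (h' - k' * sqrt D) / N\<close>, the quotient of the
    two approximations; the congruences make both coordinates of the numerator divisible by
    \<open>N\<close>.\<close>
  have "h * h' - int D * k * k' = N * (1 + h * a - int D * k * b)"
    by (simp add: a b N_def algebra_simps power2_eq_square)
  then obtain x where x: "h * h' - int D * k * k' = N * x" by blast
  have "k * h' - h * k' = N * (k * a - h * b)"
    by (simp add: a b algebra_simps)
  then obtain y where y: "k * h' - h * k' = N * y" by blast
  have "N\<^sup>2 * (x\<^sup>2 - int D * y\<^sup>2) = (N * x)\<^sup>2 - int D * (N * y)\<^sup>2"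
    by (simp add: algebra_simps power2_eq_square)
  also have "\<dots> = (h * h' - int D * k * k')\<^sup>2 - int D * (k * h' - h * k')\<^sup>2"
    by (simp only: x y)
  also have "\<dots> = (h\<^sup>2 - int D * k\<^sup>2) * (h'\<^sup>2 - int D * k'\<^sup>2)"
    by (simp add: algebra_simps power2_eq_square)
  also have "\<dots> = N\<^sup>2 * 1" by (simp only: N_def[symmetric] N'[symmetric]) (simp add: power2_eq_square)
  finally have pell: "x\<^sup>2 - int D * y\<^sup>2 = 1" using N0 by simp
  \<comment> \<open>Otherwise \<open>h / k = h' / k'\<close>, and two equal fractions in lowest
    terms with positive denominators coincide.\<close>
  have "y \<noteq> 0"
  proof
    assume "y = 0"
    then have eq: "k * h' = h * k'" using y by simp
    then have "k dvd k'" using k(3) by (metis coprime_commute coprime_dvd_mult_right_iff dvd_triv_left)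
    moreover have "k' dvd k" using eq k(4) by (metis coprime_commute coprime_dvd_mult_left_iff dvd_triv_right)
    ultimately have "k = k'" using k by (simp add: zdvd_antisym_nonneg)
    with eq k ne show False by simp
  qed
  moreover have "x \<noteq> 0"
  proof
    assume "x = 0"
    then have "int D * y\<^sup>2 = - 1" using pell by simp
    moreover have "int D * y\<^sup>2 \<ge> 0" by simp
    ultimately show False by linarith
  qed
  ultimately show thesis using pell by (intro that[of "\<bar>x\<bar>" "\<bar>y\<bar>"]) auto
qed

subsection \<open>Quadratic fields and their automorphisms\<close>

text \<open>\<open>D\<close> ranges over all nonsquares, so different \<open>D\<close> may give the
  same field. This admits \<open>D = t\<^sup>2 - 4\<close> directly, and any quadratic field after
  clearing a denominator.\<close>

locale sqrt_field =
  fixes D :: nat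
  assumes irr: "sqrt (real D) \<notin> \<rat>"
begin

abbreviation s :: real where "s \<equiv> sqrt (real D)"

definition F :: "real set" where "F = {a + b * s |a b. a \<in> \<rat> \<and> b \<in> \<rat>}"

text \<open>Galois conjugation. The coordinates \<open>a\<close>, \<open>b\<close> are unique by
  \<open>repr_unique\<close>, so the description is definite on \<open>F\<close>; outside
  \<open>F\<close> the value is unspecified.\<close>

definition cj :: "real \<Rightarrow> real" where
  "cj x = (THE y. \<exists>a\<in>\<rat>. \<exists>b\<in>\<rat>. x = a + b * s \<and> y = a - b * s)"

lemma D_pos: "D > 0"
  using irr by (cases "D = 0") auto

lemma FI [intro]: "a \<in> \<rat> \<Longrightarrow> b \<in> \<rat> \<Longrightarrow> a + b * s \<in> F"
  unfolding F_def by blast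

lemma FE [elim]: assumes "x \<in> F" obtains a b where "a \<in> \<rat>" "b \<in> \<rat>" "x = a + b * s"
  using assms unfolding F_def by blast

lemma repr_unique:
  assumes "a \<in> \<rat>" "b \<in> \<rat>" "c \<in> \<rat>" "d \<in> \<rat>" "a + b * s = c + d * s"
  shows "a = c \<and> b = d"
  using irrational_linear_eq_0[OF irr, of "a - c" "b - d"] assms by (auto simp: algebra_simps)

lemma cj_eq: "a \<in> \<rat> \<Longrightarrow> b \<in> \<rat> \<Longrightarrow> cj (a + b * s) = a - b * s"
  unfolding cj_def by (rule the_equality) (use repr_unique in blast)+

lemma cj_in: "x \<in> F \<Longrightarrow> cj x \<in> F"
proof (elim FE)
  fix a b assume "a \<in> \<rat>" "b \<in> \<rat>" "x = a + b * s"
  then show ?thesis using FI[of a "- b"] by (simp add: cj_eq)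
qed

lemma cj_cj: "x \<in> F \<Longrightarrow> cj (cj x) = x"
proof (elim FE)
  fix a b assume "a \<in> \<rat>" "b \<in> \<rat>" "x = a + b * s"
  then show ?thesis using cj_eq[of a "- b"] by (simp add: cj_eq)
qed

lemma F_add: "x \<in> F \<Longrightarrow> y \<in> F \<Longrightarrow> x + y \<in> F"
  and cj_add: "x \<in> F \<Longrightarrow> y \<in> F \<Longrightarrow> cj (x + y) = cj x + cj y"
proof -
  assume "x \<in> F" "y \<in> F"
  then obtain a b c d where *: "a \<in> \<rat>" "b \<in> \<rat>" "x = a + b * s" "c \<in> \<rat>" "d \<in> \<rat>" "y = c + d * s"
    by (elim FE) blast
  have eq: "x + y = (a + c) + (b + d) * s" using * by (simp add: algebra_simps)
  show "x + y \<in> F" unfolding eq using * by (intro FI) auto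
  show "cj (x + y) = cj x + cj y"
    unfolding eq using * by (subst cj_eq) (auto simp: cj_eq algebra_simps)
qed

lemma F_mult: "x \<in> F \<Longrightarrow> y \<in> F \<Longrightarrow> x * y \<in> F"
  and cj_mult: "x \<in> F \<Longrightarrow> y \<in> F \<Longrightarrow> cj (x * y) = cj x * cj y"
proof -
  assume "x \<in> F" "y \<in> F"
  then obtain a b c d where *: "a \<in> \<rat>" "b \<in> \<rat>" "x = a + b * s" "c \<in> \<rat>" "d \<in> \<rat>" "y = c + d * s"
    by (elim FE) blast
  have eq: "x * y = (a * c + real D * b * d) + (a * d + b * c) * s"
    using * by (simp add: algebra_simps)
  show "x * y \<in> F" unfolding eq using * by (intro FI) auto
  show "cj (x * y) = cj x * cj y"
    unfolding eq using * by (subst cj_eq) (auto simp: cj_eq algebra_simps)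
qed

lemma Rats_F: "x \<in> \<rat> \<Longrightarrow> x \<in> F"
  using FI[of x 0] by simp

lemma cj_Rats: "x \<in> \<rat> \<Longrightarrow> cj x = x"
  using cj_eq[of x 0] by simp

lemma s_in: "s \<in> F" and cj_s: "cj s = - s"
  using FI[of 0 1] cj_eq[of 0 1] by auto

text \<open>Invariance forces \<open>2 * b * s = 0\<close>, hence \<open>b = 0\<close>. This turns
  the invariance of traces and norms into their rationality.\<close>

lemma cj_fixed_iff: assumes "x \<in> F" shows "cj x = x \<longleftrightarrow> x \<in> \<rat>"
proof
  assume "cj x = x"
  from assms obtain a b where *: "a \<in> \<rat>" "b \<in> \<rat>" "x = a + b * s" by blast
  then have "2 * b * s = 0" using \<open>cj x = x\<close> by (simp add: cj_eq)
  then show "x \<in> \<rat>" using * by auto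
qed (rule cj_Rats)

lemma F_uminus: "x \<in> F \<Longrightarrow> - x \<in> F"
  using F_mult[of "-1" x] Rats_F[of "-1"] by simp

lemma cj_uminus: "x \<in> F \<Longrightarrow> cj (- x) = - cj x"
  using cj_mult[of "-1" x] Rats_F[of "-1"] cj_Rats[of "-1"] by simp

lemma cj_diff: "x \<in> F \<Longrightarrow> y \<in> F \<Longrightarrow> cj (x - y) = cj x - cj y"
  using cj_add[of x "- y"] by (simp add: F_uminus cj_uminus)

lemma trace_Rats: "x \<in> F \<Longrightarrow> x + cj x \<in> \<rat>"
  using cj_fixed_iff[of "x + cj x"] by (simp add: F_add cj_in cj_add cj_cj)

lemma norm_Rats: "x \<in> F \<Longrightarrow> x * cj x \<in> \<rat>"
  using cj_fixed_iff[of "x * cj x"] by (simp add: F_mult cj_in cj_mult cj_cj)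

lemma cj_eq_0_iff: "x \<in> F \<Longrightarrow> cj x = 0 \<longleftrightarrow> x = 0"
  by (metis cj_cj cj_Rats Rats_0)

lemma F_inverse: "x \<in> F \<Longrightarrow> inverse x \<in> F"
proof (cases "x = 0")
  case False
  assume x: "x \<in> F"
  then have "inverse x = inverse (x * cj x) * cj x"
    using False by (simp add: cj_eq_0_iff field_simps)
  then show ?thesis
    using norm_Rats[OF x] by (metis F_mult Rats_F Rats_inverse cj_in x)
qed (auto intro: Rats_F)

lemma subfield_F: "real_subfield F"
  unfolding real_subfield_def by (auto intro: Rats_F F_add F_mult F_uminus F_inverse)

lemma real_quadratic_field_F: "real_quadratic_field F"
proof -
  interpret Q: vector_space "\<lambda>(q::rat) (x::real). of_rat q * x"
    by (rule vector_space_rat_real)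
  have "Q.dim F = 2"
  proof (rule Q.dim_unique)
    show "{1, s} \<subseteq> F" using s_in Rats_F[of 1] by auto
    have "s \<noteq> 1" using irr by auto
    then show "card {1, s} = 2" by simp
    have "s \<notin> Q.span {1}"
      using irr by (auto simp: Q.span_singleton)
    then show "Q.independent {1, s}"
      by (subst insert_commute) (simp add: Q.independent_insert)
    show "F \<subseteq> Q.span {1, s}"
    proof
      fix x assume "x \<in> F"
      then obtain a b where *: "a \<in> \<rat>" "b \<in> \<rat>" "x = a + b * s" by blast
      then obtain p q where "a = of_rat p" "b = of_rat q" by (auto elim!: Rats_cases)
      then have "x = of_rat p * 1 + of_rat q * s" using * by simp
      then show "x \<in> Q.span {1, s}"
        by (metis Q.span_add Q.span_scale Q.span_base insertI1 insertI2)
    qed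
  qed
  then show ?thesis unfolding real_quadratic_field_def using subfield_F by simp
qed

text \<open>An automorphism fixes the rationals and sends \<open>s\<close> to a square root of
  \<open>D\<close>, that is to \<open>s\<close> or \<open>-s\<close>. This determines it on
  \<open>F\<close>, and extensionality determines it elsewhere.\<close>

lemma field_auts_F: "field_auts F = {restrict id F, restrict cj F}"
proof (intro equalityI subsetI)
  fix \<sigma> assume "\<sigma> \<in> field_auts F"
  then have ext: "\<sigma> \<in> extensional F" and bij: "bij_betw \<sigma> F F" and one: "\<sigma> 1 = 1"
    and add: "\<And>x y. x \<in> F \<Longrightarrow> y \<in> F \<Longrightarrow> \<sigma> (x + y) = \<sigma> x + \<sigma> y"
    and mult: "\<And>x y. x \<in> F \<Longrightarrow> y \<in> F \<Longrightarrow> \<sigma> (x * y) = \<sigma> x * \<sigma> y"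
    by (auto simp: field_auts_def)
  have nat: "\<sigma> (of_nat n) = of_nat n" for n
  proof (induction n)
    case 0
    show ?case using add[of 0 0] Rats_F[of 0] by simp
  next
    case (Suc n)
    then show ?case using add[of 1 "of_nat n"] Rats_F one by simp
  qed
  have neg: "\<sigma> (- x) = - \<sigma> x" if "x \<in> F" for x
    using add[of x "- x"] that nat[of 0] F_uminus by simp
  have int: "\<sigma> (of_int n) = of_int n" for n
    by (cases n rule: int_cases2) (simp_all add: nat neg Rats_F)
  have rat: "\<sigma> q = q" if "q \<in> \<rat>" for q
  proof -
    from that obtain a b where ab: "q = of_int a / of_int b" "b > 0" by (auto elim!: Rats_cases')
    then have "q * of_int b = of_int a" by simp
    then have "\<sigma> q * of_int b = q * of_int b" using mult[of q "of_int b"] that int Rats_F by force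
    then show ?thesis using ab(2) by simp
  qed
  have "\<sigma> s * \<sigma> s = s * s"
    using mult[OF s_in s_in] rat[of "real D"] by simp
  then have "\<sigma> s = s \<or> \<sigma> s = - s" by (simp only: square_eq_iff)
  then consider "\<sigma> s = s" | "\<sigma> s = - s" by blast
  then show "\<sigma> \<in> {restrict id F, restrict cj F}"
  proof cases
    case 1
    have "\<sigma> = restrict id F"
    proof (rule extensionalityI[OF ext])
      fix x assume "x \<in> F"
      then obtain a b where "a \<in> \<rat>" "b \<in> \<rat>" "x = a + b * s" by blast
      with \<open>x \<in> F\<close> 1 show "\<sigma> x = restrict id F x"
        by (simp add: add mult rat Rats_F s_in F_mult)
    qed auto
    then show ?thesis by simp
  next
    case 2
    have "\<sigma> = restrict cj F"
    proof (rule extensionalityI[OF ext])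
      fix x assume "x \<in> F"
      then obtain a b where "a \<in> \<rat>" "b \<in> \<rat>" "x = a + b * s" by blast
      with \<open>x \<in> F\<close> 2 show "\<sigma> x = restrict cj F x"
        by (simp add: add mult rat Rats_F s_in F_mult cj_eq)
    qed auto
    then show ?thesis by simp
  qed
next
  have one: "1 \<in> F" by (simp add: Rats_F)
  fix \<sigma> assume "\<sigma> \<in> {restrict id F, restrict cj F}"
  then consider "\<sigma> = restrict id F" | "\<sigma> = restrict cj F" by blast
  then show "\<sigma> \<in> field_auts F"
  proof cases
    case 1
    have "bij_betw \<sigma> F F" unfolding 1 by (simp add: bij_betw_def inj_on_def)
    then show ?thesis unfolding field_auts_def using one by (simp add: 1 F_add F_mult)
  next
    case 2
    have "bij_betw cj F F"
      by (rule bij_betw_byWitness[where f' = cj]) (auto simp: cj_cj cj_in)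
    then have "bij_betw \<sigma> F F" unfolding 2 by (subst bij_betw_cong[of _ _ cj]) auto
    then show ?thesis unfolding field_auts_def
      using one by (simp add: 2 F_add F_mult cj_add cj_mult cj_Rats)
  qed
qed

text \<open>Ensures that the norm has two factors and the trace two summands.\<close>

lemma restrict_id_neq_cj: "restrict id F \<noteq> restrict cj F"
proof
  assume "restrict id F = restrict cj F"
  then have "s = cj s" using s_in by (metis id_apply restrict_apply')
  then show False using cj_s irr by auto
qed

lemma field_norm_F: "x \<in> F \<Longrightarrow> field_norm F x = x * cj x"
  and field_trace_F: "x \<in> F \<Longrightarrow> field_trace F x = x + cj x"
  unfolding field_norm_def field_trace_def field_auts_F using restrict_id_neq_cj by simp_all

subsection \<open>Integers, discriminant and units\<close>

lemma root_of_conj_poly: "x\<^sup>2 = (x + cj x) * x - x * cj x"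
  by (simp add: algebra_simps power2_eq_square)

text \<open>For irrational \<open>x\<close> the trace and the norm are, up to sign, the coefficients
  of its minimal polynomial; rational \<open>x\<close> are treated apart. Closure properties thereby
  become arithmetic with traces and norms.\<close>

lemma ring_of_integers_F: "ring_of_integers F = {x \<in> F. x + cj x \<in> \<int> \<and> x * cj x \<in> \<int>}"
proof (intro equalityI subsetI)
  fix x assume "x \<in> ring_of_integers F"
  then have x: "x \<in> F" "algebraic_int x" by (auto simp: ring_of_integers_def)
  show "x \<in> {x \<in> F. x + cj x \<in> \<int> \<and> x * cj x \<in> \<int>}"
  proof (cases "x \<in> \<rat>")
    case True
    then have "x \<in> \<int>" using x rational_algebraic_int_is_int by blast
    then show ?thesis using x True by (simp add: cj_Rats)
  next
    case False
    then show ?thesis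
      using algebraic_int_quadratic_coeffs[OF False x(2) trace_Rats norm_Rats root_of_conj_poly] x
      by simp
  qed
next
  fix x assume "x \<in> {x \<in> F. x + cj x \<in> \<int> \<and> x * cj x \<in> \<int>}"
  then show "x \<in> ring_of_integers F"
    using algebraic_int_monic_quadratic[OF _ _ root_of_conj_poly, of x] by (simp add: ring_of_integers_def)
qed

abbreviation "int_F \<equiv> ring_of_integers F"

lemma int_F_D:
  assumes "x \<in> int_F" shows "x \<in> F" "x + cj x \<in> \<int>" "x * cj x \<in> \<int>"
  using assms by (auto simp: ring_of_integers_F)

text \<open>
  \<open>x z + x' z'\<close> and \<open>x z' + x' z\<close> are rational and their sum and product are integers, so both
  are rational algebraic integers.
\<close>

lemma mixed_traces_Ints:
  assumes x: "x \<in> int_F" and z: "z \<in> int_F"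
  shows "x * z + cj x * cj z \<in> \<int>" "x * cj z + cj x * z \<in> \<int>"
proof -
  define A where "A = x * z + cj x * cj z"
  define B where "B = x * cj z + cj x * z"
  note X = int_F_D[OF x] and Z = int_F_D[OF z]
  have sum: "A + B \<in> \<int>"
  proof -
    have "A + B = (x + cj x) * (z + cj z)" by (simp add: A_def B_def algebra_simps)
    then show ?thesis using X Z by simp
  qed
  have prod: "A * B \<in> \<int>"
  proof -
    \<comment> \<open>Expanding gives \<open>x x' (z\<^sup>2 + z'\<^sup>2) + z z' (x\<^sup>2 +
      x'\<^sup>2)\<close>, and each sum of squares is a squared trace minus twice a norm.\<close>
    have "A * B = (x * cj x) * ((z + cj z)\<^sup>2 - 2 * (z * cj z)) + (z * cj z) * ((x + cj x)\<^sup>2 - 2 * (x * cj x))"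
      by (simp add: A_def B_def algebra_simps power2_eq_square)
    then show ?thesis using X Z by simp
  qed
  have "A \<in> \<rat>"
    using trace_Rats[of "x * z"] X Z by (simp add: A_def F_mult cj_mult)
  moreover have "algebraic_int A"
    using sum prod by (rule algebraic_int_monic_quadratic) (simp add: algebra_simps power2_eq_square)
  ultimately show A: "x * z + cj x * cj z \<in> \<int>"
    using rational_algebraic_int_is_int by (simp add: A_def)
  have "B = (A + B) - A" by simp
  then show "x * cj z + cj x * z \<in> \<int>" using sum A by (metis A_def B_def Ints_diff)
qed

lemma int_F_mult: assumes x: "x \<in> int_F" and z: "z \<in> int_F" shows "x * z \<in> int_F"
proof -
  note X = int_F_D[OF x] and Z = int_F_D[OF z]
  have "x * z * cj (x * z) = (x * cj x) * (z * cj z)"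
    using X Z by (simp add: cj_mult)
  then have "x * z * cj (x * z) \<in> \<int>" using X Z by (metis Ints_mult)
  then show ?thesis
    using mixed_traces_Ints[OF x z] X Z by (simp add: ring_of_integers_F F_mult cj_mult)
qed

text \<open>The cross term in the norm of a sum is the second mixed trace, just as the trace of a
  product is the first.\<close>

lemma int_F_add: assumes x: "x \<in> int_F" and z: "z \<in> int_F" shows "x + z \<in> int_F"
proof -
  note X = int_F_D[OF x] and Z = int_F_D[OF z]
  have "(x + z) * cj (x + z) = x * cj x + z * cj z + (x * cj z + cj x * z)"
    using X Z by (simp add: cj_add algebra_simps)
  moreover have "x + z + cj (x + z) = (x + cj x) + (z + cj z)"
    using X Z by (simp add: cj_add)
  ultimately have "(x + z) * cj (x + z) \<in> \<int>" "x + z + cj (x + z) \<in> \<int>"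
    using mixed_traces_Ints[OF x z] X Z by (metis Ints_add)+
  then show ?thesis
    using X Z by (simp add: ring_of_integers_F F_add)
qed

lemma int_F_Ints: "x \<in> \<int> \<Longrightarrow> x \<in> int_F"
  using Ints_subset_Rats by (auto simp: ring_of_integers_F Rats_F cj_Rats)

lemma int_F_uminus: "x \<in> int_F \<Longrightarrow> - x \<in> int_F"
  using int_F_mult[OF int_F_Ints[of "-1"], of x] by simp

lemma int_F_Rats: "x \<in> int_F \<Longrightarrow> x \<in> \<rat> \<Longrightarrow> x \<in> \<int>"
  by (simp add: ring_of_integers_def rational_algebraic_int_is_int)

lemma int_F_cj: "x \<in> int_F \<Longrightarrow> cj x \<in> int_F"
  by (auto simp: ring_of_integers_F cj_in cj_cj add.commute mult.commute)

lemma s_in_int_F: "s \<in> int_F"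
  by (simp add: ring_of_integers_F s_in cj_s)

text \<open>The values \<open>x - x'\<close> for integers \<open>x\<close> form a discrete group; \<open>w\<close> is chosen to give a generator.\<close>

lemma integral_basis_exists: "\<exists>w. integral_basis F 1 w"
proof -
  have sq: "(x - cj x)\<^sup>2 \<in> \<int>" if "x \<in> int_F" for x
  proof -
    have "(x - cj x)\<^sup>2 = (x + cj x)\<^sup>2 - 4 * (x * cj x)" by (simp add: algebra_simps power2_eq_square)
    then show ?thesis using int_F_D[OF that] by simp
  qed
  \<comment> \<open>The square of \<open>x - x'\<close> is a nonnegative integer on
    \<open>int_F\<close>, so it can be minimised there as a natural number over the \<open>x\<close>
    with \<open>x \<noteq> x'\<close>.\<close>
  define m where "m = (\<lambda>x. nat \<lfloor>(x - cj x)\<^sup>2\<rfloor>)"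
  have m: "real (m x) = (x - cj x)\<^sup>2" if "x \<in> int_F" for x
    using sq[OF that] by (auto simp: m_def Ints_def)
  have "s \<in> int_F \<and> s \<noteq> cj s" using s_in_int_F D_pos by (simp add: cj_s)
  then obtain w where w: "w \<in> int_F" "w \<noteq> cj w"
    and min: "\<And>x. x \<in> int_F \<Longrightarrow> x \<noteq> cj x \<Longrightarrow> m w \<le> m x"
    using ex_has_least_nat[of "\<lambda>x. x \<in> int_F \<and> x \<noteq> cj x" s m] by blast
  have wirr: "w \<notin> \<rat>" using w cj_Rats by metis
  have "integral_basis F 1 w"
    unfolding integral_basis_def bij_betw_def
  proof
    show "inj (\<lambda>(a::int, b::int). of_int a * 1 + of_int b * w)"
    proof (rule injI, clarify)
      fix a b c d :: int
      assume "of_int a * 1 + of_int b * w = of_int c * 1 + of_int d * w"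
      then have "of_int (a - c) + of_int (b - d) * w = 0" by (simp add: algebra_simps)
      from irrational_linear_eq_0[OF wirr _ _ this] show "a = c \<and> b = d" by simp
    qed
    show "range (\<lambda>(a::int, b::int). of_int a * 1 + of_int b * w) = int_F"
    proof (intro equalityI subsetI)
      fix x assume "x \<in> range (\<lambda>(a::int, b::int). of_int a * 1 + of_int b * w)"
      then show "x \<in> int_F" by (auto intro!: int_F_add int_F_mult[OF int_F_Ints w(1)] int_F_Ints[OF Ints_of_int])
    next
      fix x assume x: "x \<in> int_F"
      \<comment> \<open>Division with remainder: rounding the quotient down leaves \<open>z\<close>
        with \<open>\<bar>z - z'\<bar> < \<bar>w - w'\<bar>\<close>. Minimality of \<open>w\<close>
        gives \<open>z = z'\<close>, so \<open>z\<close> is an ordinary integer.\<close>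
      define k where "k = \<lfloor>(x - cj x) / (w - cj w)\<rfloor>"
      define z where "z = x - of_int k * w"
      have kw: "of_int k * w \<in> int_F" by (intro int_F_mult int_F_Ints w(1)) simp
      have z: "z \<in> int_F" using int_F_add[OF x int_F_uminus[OF kw]] by (simp add: z_def)
      have "cj z = cj x - of_int k * cj w"
        using int_F_D[OF x] int_F_D[OF w(1)] by (simp add: z_def cj_diff cj_mult F_mult Rats_F cj_Rats)
      then have "z - cj z = (x - cj x) - of_int k * (w - cj w)"
        by (simp add: z_def algebra_simps)
      then have "z - cj z = frac ((x - cj x) / (w - cj w)) * (w - cj w)"
        using w(2) by (simp add: frac_def k_def left_diff_distrib[of "(x - cj x) / (w - cj w)"])
      then have "(z - cj z)\<^sup>2 = (frac ((x - cj x) / (w - cj w)))\<^sup>2 * (w - cj w)\<^sup>2"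
        by (simp add: power_mult_distrib)
      also have "\<dots> < 1 * (w - cj w)\<^sup>2"
        using w(2) by (intro mult_strict_right_mono) (auto simp: frac_lt_1 power_less_one_iff abs_square_less_1)
      finally have "real (m z) < real (m w)" using m[OF z] m[OF w(1)] by simp
      then have "z = cj z" using min[OF z] by force
      then have "z \<in> \<int>" using int_F_Rats[OF z] cj_fixed_iff[of z] int_F_D[OF z] by simp
      then obtain a where "z = of_int a" by (auto simp: Ints_def)
      then have "x = of_int a * 1 + of_int k * w" by (simp add: z_def)
      then show "x \<in> range (\<lambda>(a::int, b::int). of_int a * 1 + of_int b * w)" by force
    qed
  qed
  then show ?thesis by blast
qed

section \<open>The discriminant: independence of the basis and nonvanishing\<close>

abbreviation "basis_disc w1 w2 \<equiv>
  field_trace F (w1 * w1) * field_trace F (w2 * w2) - (field_trace F (w1 * w2))\<^sup>2"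

text \<open>The matrix of the trace form is the transpose of \<open>M\<close> times
  \<open>M\<close>, where \<open>M\<close> has rows \<open>w1, w2\<close> and
  \<open>cj w1, cj w2\<close>; hence its determinant is the square of that of
  \<open>M\<close>.\<close>

lemma basis_disc_eq: "w1 \<in> F \<Longrightarrow> w2 \<in> F \<Longrightarrow> basis_disc w1 w2 = (w1 * cj w2 - w2 * cj w1)\<^sup>2"
  by (simp add: field_trace_F F_mult cj_mult algebra_simps power2_eq_square)

lemma integral_basis_in_int_F:
  assumes "integral_basis F w1 w2" shows "w1 \<in> int_F" "w2 \<in> int_F"
proof -
  have r: "range (\<lambda>(a::int, b::int). of_int a * w1 + of_int b * w2) = int_F"
    using assms by (simp add: integral_basis_def bij_betw_def)
  show "w1 \<in> int_F" unfolding r[symmetric] by (rule image_eqI[of _ _ "(1, 0)"]) auto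
  show "w2 \<in> int_F" unfolding r[symmetric] by (rule image_eqI[of _ _ "(0, 1)"]) auto
qed

text \<open>\<open>k\<close> is the determinant of the integer matrix that expresses the second
  basis by the first. Applied in both directions, this gives \<open>k\<^sup>2 = 1\<close>
  below.\<close>

lemma basis_disc_change:
  assumes w: "integral_basis F w1 w2" and v: "integral_basis F v1 v2"
  shows "\<exists>k::int. basis_disc v1 v2 = (of_int k)\<^sup>2 * basis_disc w1 w2"
proof -
  have r: "range (\<lambda>(a::int, b::int). of_int a * w1 + of_int b * w2) = int_F"
    using w by (simp add: integral_basis_def bij_betw_def)
  obtain a b :: int where v1: "v1 = of_int a * w1 + of_int b * w2"
    using integral_basis_in_int_F(1)[OF v] unfolding r[symmetric] by auto
  obtain c d :: int where v2: "v2 = of_int c * w1 + of_int d * w2"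
    using integral_basis_in_int_F(2)[OF v] unfolding r[symmetric] by auto
  have wF: "w1 \<in> F" "w2 \<in> F" "v1 \<in> F" "v2 \<in> F"
    using integral_basis_in_int_F[OF w] integral_basis_in_int_F[OF v] int_F_D(1) by blast+
  have c1: "cj v1 = of_int a * cj w1 + of_int b * cj w2"
    using wF by (simp add: v1 cj_add cj_mult F_mult Rats_F cj_Rats)
  have c2: "cj v2 = of_int c * cj w1 + of_int d * cj w2"
    using wF by (simp add: v2 cj_add cj_mult F_mult Rats_F cj_Rats)
  have "v1 * cj v2 - v2 * cj v1 = of_int (a * d - b * c) * (w1 * cj w2 - w2 * cj w1)"
    unfolding c1 c2 by (simp add: v1 v2 algebra_simps)
  then have "basis_disc v1 v2 = (of_int (a * d - b * c))\<^sup>2 * basis_disc w1 w2"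
    by (simp only: basis_disc_eq wF power_mult_distrib)
  then show ?thesis by blast
qed

text \<open>The definite description is justified by the existence of one integral basis and the
  agreement of all of them. Nonvanishing is what lets the discriminant cancel in
  \<open>rank_grid\<close>.\<close>

lemma field_disc_nonzero: "field_disc F \<noteq> 0"
proof -
  obtain w where w: "integral_basis F 1 w" using integral_basis_exists by blast
  have wO: "w \<in> int_F" and wF: "w \<in> F" using integral_basis_in_int_F(2)[OF w] int_F_D(1) by auto
  have "w \<noteq> cj w"
  proof
    assume "w = cj w"
    then have "w \<in> \<int>" using int_F_Rats[OF wO] cj_fixed_iff[OF wF] by simp
    then obtain a where a: "w = of_int a" by (auto simp: Ints_def)
    have "inj (\<lambda>(a::int, b::int). of_int a * 1 + of_int b * w)"
      using w by (simp add: integral_basis_def bij_betw_def)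
    from injD[OF this, of "(0, 1)" "(a, 0)"] show False by (simp add: a)
  qed
  then have nz: "basis_disc 1 w \<noteq> 0"
    using wF basis_disc_eq[of 1 w] Rats_F[of 1] cj_Rats[of 1] by simp
  have "field_disc F = basis_disc 1 w"
    unfolding field_disc_def
  proof (rule the_equality)
    fix d assume "\<exists>w1 w2. integral_basis F w1 w2 \<and> d = basis_disc w1 w2"
    then obtain v1 v2 where v: "integral_basis F v1 v2" and d: "d = basis_disc v1 v2" by blast
    obtain k :: int where k: "d = (of_int k)\<^sup>2 * basis_disc 1 w"
      using basis_disc_change[OF w v] d by blast
    obtain l :: int where l: "basis_disc 1 w = (of_int l)\<^sup>2 * d"
      using basis_disc_change[OF v w] d by blast
    \<comment> \<open>Going from one basis to the other and back multiplies the discriminant by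
      \<open>(l * k)\<^sup>2\<close>, which must therefore be 1.\<close>
    have "basis_disc 1 w * real_of_int ((l * k)\<^sup>2) = basis_disc 1 w * 1"
      using l unfolding k by (simp add: power_mult_distrib algebra_simps)
    then have "real_of_int ((l * k)\<^sup>2) = 1" using nz by simp
    then have "(l * k)\<^sup>2 = 1" by linarith
    then have "\<bar>k\<bar> = 1" by (metis abs_mult abs_zmult_eq_1 mult.commute power2_eq_1_iff abs_1 abs_minus_cancel)
    then have "k\<^sup>2 = 1" by (simp add: abs_square_eq_1)
    then show "d = basis_disc 1 w" using k by (metis mult_1 of_int_1 of_int_power)
  qed (use w in blast)
  with nz show ?thesis by simp
qed

section \<open>Units of norm 1 and the fundamental one\<close>

definition norm_one_units :: "real set" where "norm_one_units = {u \<in> int_F. u * cj u = 1 \<and> u > 1}"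

text \<open>The conjugate of an integer of norm 1 is again an integer and serves as the inverse,
  which puts it in the unit group.\<close>

lemma norm_one_unit_iff: "u \<in> unit_group F \<and> field_norm F u = 1 \<and> u > 1 \<longleftrightarrow> u \<in> norm_one_units"
  using int_F_D int_F_cj by (auto simp: norm_one_units_def unit_group_def field_norm_F)

lemma norm_one_units_cj: "u \<in> norm_one_units \<Longrightarrow> cj u = inverse u"
  by (auto simp: norm_one_units_def inverse_unique)

lemma norm_one_units_irrational: assumes "u \<in> norm_one_units" shows "u \<notin> \<rat>"
proof
  assume "u \<in> \<rat>"
  then have "u * u = 1" using assms cj_Rats by (simp add: norm_one_units_def)
  moreover have "u > 1" using assms by (simp add: norm_one_units_def)
  ultimately show False using less_1_mult[of u u] by simp
qed

text \<open>A positive solution of Pell's equation gives \<open>x + y * s\<close>, whose norm is 1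
  and which exceeds 1 because \<open>x \<ge> 1\<close> and \<open>y * s > 0\<close>.\<close>

lemma norm_one_units_nonempty: "norm_one_units \<noteq> {}"
proof -
  obtain x y :: int where xy: "x\<^sup>2 - int D * y\<^sup>2 = 1" "x > 0" "y > 0"
    by (rule Pell_solution_exists[OF irr])
  define u where "u = of_int x + of_int y * s"
  have cj: "cj u = of_int x - of_int y * s" by (simp add: u_def cj_eq)
  have "u \<in> int_F" unfolding u_def by (intro int_F_add int_F_mult int_F_Ints s_in_int_F) auto
  moreover have "u * cj u = real_of_int (x\<^sup>2 - int D * y\<^sup>2)"
    unfolding cj by (simp add: u_def algebra_simps power2_eq_square)
  moreover have "u > 1"
  proof -
    have "of_int y * s > 0" using xy D_pos by simp
    moreover have "of_int x \<ge> (1::real)" using xy by simp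
    ultimately show ?thesis unfolding u_def by linarith
  qed
  ultimately have "u \<in> norm_one_units" by (simp add: norm_one_units_def xy)
  then show ?thesis by blast
qed

abbreviation "eps \<equiv> norm_one_unit F"

text \<open>\<open>LEAST\<close> on reals is meaningful only if a minimum is attained. The trace
  \<open>u + inverse u\<close> is a positive integer that increases with \<open>u > 1\<close>, so a
  unit of minimal trace is the least unit.\<close>

lemma eps_least: "eps \<in> norm_one_units \<and> (\<forall>u\<in>norm_one_units. eps \<le> u)"
proof -
  define m where "m = (\<lambda>u::real. nat \<lfloor>u + inverse u\<rfloor>)"
  have m: "real (m u) = u + inverse u" if "u \<in> norm_one_units" for u
  proof -
    have "u + cj u \<in> \<int>" using that int_F_D(2) by (simp add: norm_one_units_def)
    then have "u + inverse u \<in> \<int>" using norm_one_units_cj[OF that] by simp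
    moreover have "u + inverse u > 0" using that by (simp add: norm_one_units_def add_pos_pos)
    ultimately show ?thesis by (auto simp: m_def Ints_def)
  qed
  obtain v where v: "v \<in> norm_one_units" and min: "\<And>u. u \<in> norm_one_units \<Longrightarrow> m v \<le> m u"
    using norm_one_units_nonempty ex_has_least_nat[of "\<lambda>u. u \<in> norm_one_units" _ m] by blast
  have le: "v \<le> u" if u: "u \<in> norm_one_units" for u
  proof (rule ccontr)
    assume "\<not> v \<le> u"
    then have "u + inverse u < v + inverse v"
      using u v by (intro add_inverse_strict_mono) (auto simp: norm_one_units_def)
    then have "m u < m v" using m[OF u] m[OF v] by linarith
    then show False using min[OF u] by simp
  qed
  have "eps = v"
    unfolding norm_one_unit_def norm_one_unit_iff by (rule Least_equality) (use v le in auto)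
  then show ?thesis using v le by simp
qed

lemma eps_gt_1: "eps > 1"
  using eps_least by (simp add: norm_one_units_def)

lemma norm_one_units_power: assumes "u \<in> norm_one_units" "j > 0" shows "u ^ j \<in> norm_one_units"
  using assms(2)
proof (induction j rule: nat_induct_non_zero)
  case (Suc n)
  have "u > 1" using assms by (simp add: norm_one_units_def)
  moreover have "u ^ n > 1" using Suc by (simp add: norm_one_units_def)
  ultimately have "u * u ^ n > 1" by (rule less_1_mult)
  moreover have "u * u ^ n \<in> int_F" using Suc assms int_F_mult by (simp add: norm_one_units_def)
  moreover have "u * u ^ n * cj (u * u ^ n) = 1"
  proof -
    have "u \<in> F" "u ^ n \<in> F" using Suc assms int_F_D(1) by (auto simp: norm_one_units_def)
    then have "u * u ^ n * cj (u * u ^ n) = (u * cj u) * (u ^ n * cj (u ^ n))"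
      by (simp add: cj_mult mult_ac)
    also have "\<dots> = 1" using Suc assms by (simp add: norm_one_units_def)
    finally show ?thesis .
  qed
  ultimately show ?case by (simp add: norm_one_units_def)
qed (use assms in auto)

text \<open>Dividing \<open>u\<close> by the largest power of \<open>eps\<close> that does not
  exceed it leaves a quotient in \<open>[1, eps)\<close> of norm 1; minimality of \<open>eps\<close>
  makes it 1.\<close>

lemma norm_one_units_eps_power: assumes u: "u \<in> norm_one_units" shows "\<exists>j>0. u = eps ^ j"
proof -
  have u1: "u > 1" using u by (simp add: norm_one_units_def)
  obtain n where n: "u < eps ^ n" using real_arch_pow[OF eps_gt_1] by blast
  \<comment> \<open>\<open>k\<close> is the first exponent whose power exceeds \<open>u\<close>, so
    \<open>j = k - 1\<close> is the largest with \<open>eps ^ j \<le> u\<close>.\<close>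
  define k where "k = (LEAST n. u < eps ^ n)"
  have k: "u < eps ^ k" unfolding k_def using n by (rule LeastI)
  have "k \<noteq> 0" using k u1 by (intro notI) simp
  then obtain j where j: "k = Suc j" by (cases k) auto
  have le: "eps ^ j \<le> u" using not_less_Least[of j "\<lambda>n. u < eps ^ n"] j by (simp add: k_def)
  have j0: "j > 0"
  proof (rule ccontr)
    assume "\<not> j > 0"
    then have "u < eps" using k j by simp
    then show False using eps_least u by force
  qed
  have e: "eps ^ j \<in> norm_one_units" using norm_one_units_power eps_least j0 by blast
  \<comment> \<open>The quotient is written with the conjugate, so that it is visibly an algebraic
    integer of the field.\<close>
  define v where "v = u * cj (eps ^ j)"
  have v: "v = u / eps ^ j" using norm_one_units_cj[OF e] by (simp add: v_def divide_inverse)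
  have ePos: "eps ^ j > 0" using eps_gt_1 by simp
  have "u = eps ^ j"
  proof (rule ccontr)
    assume "u \<noteq> eps ^ j"
    then have "v > 1" using le ePos by (simp add: v)
    moreover have "v \<in> int_F" using u e int_F_mult int_F_cj by (simp add: norm_one_units_def v_def)
    moreover have "v * cj v = (u * cj u) * (eps ^ j * cj (eps ^ j))"
    proof -
      have "u \<in> F" "eps ^ j \<in> F" using u e int_F_D(1) by (auto simp: norm_one_units_def)
      then have "cj v = cj u * eps ^ j" by (simp add: v_def cj_mult cj_cj cj_in)
      then show ?thesis by (simp add: v_def mult_ac)
    qed
    ultimately have "v \<in> norm_one_units" using u e by (simp add: norm_one_units_def)
    then have "eps \<le> v" using eps_least by blast
    then show False using k ePos by (simp add: j v field_simps)
  qed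
  with j0 show ?thesis by blast
qed

end

subsection \<open>Lucas sequences and the grids\<close>

text \<open>Since \<open>x = a + b * s\<close> with \<open>b \<noteq> 0\<close>, this can be solved
  for \<open>s\<close>. Any irrational element thus recovers the field, which is the key to the
  uniqueness of \<open>K\<close>.\<close>

lemma (in sqrt_field) F_eq_rational_span:
  assumes x: "x \<in> F" "x \<notin> \<rat>"
  shows "F = {a + b * x |a b. a \<in> \<rat> \<and> b \<in> \<rat>}"
proof (intro equalityI subsetI)
  fix y assume "y \<in> {a + b * x |a b. a \<in> \<rat> \<and> b \<in> \<rat>}"
  then show "y \<in> F" using x Rats_F by (auto intro!: F_add F_mult)
next
  fix y assume "y \<in> F"
  then obtain c d where y: "c \<in> \<rat>" "d \<in> \<rat>" "y = c + d * s" by blast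
  from x obtain a b where ab: "a \<in> \<rat>" "b \<in> \<rat>" "x = a + b * s" by blast
  have "b \<noteq> 0" using x ab by auto
  then have "y = (c - d * a / b) + (d / b) * x" using ab y by (simp add: field_simps)
  moreover have "c - d * a / b \<in> \<rat>" "d / b \<in> \<rat>" using y ab by auto
  ultimately show "y \<in> {a + b * x |a b. a \<in> \<rat> \<and> b \<in> \<rat>}" by blast
qed

section \<open>Every real quadratic field has the form \<open>F\<close>\<close>

lemma Rats_subset_real_subfield:
  assumes "real_subfield K" shows "\<rat> \<subseteq> K"
proof
  have K: "0 \<in> K" "1 \<in> K" "\<And>x y. x \<in> K \<Longrightarrow> y \<in> K \<Longrightarrow> x + y \<in> K"
    "\<And>x y. x \<in> K \<Longrightarrow> y \<in> K \<Longrightarrow> x * y \<in> K" "\<And>x. x \<in> K \<Longrightarrow> - x \<in> K" "\<And>x. x \<in> K \<Longrightarrow> inverse x \<in> K"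
    using assms by (auto simp: real_subfield_def)
  have nat: "of_nat n \<in> K" for n by (induction n) (auto intro: K)
  have int: "of_int n \<in> K" for n by (cases n rule: int_cases2) (auto intro: K nat)
  fix q :: real assume "q \<in> \<rat>"
  then obtain a b where "q = of_int a / of_int b" by (auto elim!: Rats_cases')
  then show "q \<in> K" by (simp add: divide_inverse K int)
qed

text \<open>Extend \<open>{1}\<close> to a basis \<open>{1, w}\<close>. Completing the square in
  \<open>w * w = p + q * w\<close> gives \<open>v = w - q / 2\<close> with
  \<open>v\<^sup>2 = a / b\<close> rational, and \<open>b * v\<close> has the integer square
  \<open>D = a * b\<close>.\<close>

lemma real_quadratic_field_eq_F:
  assumes "real_quadratic_field K"
  obtains D where "sqrt_field D" "K = sqrt_field.F D"
proof -
  interpret Q: vector_space "\<lambda>(q::rat) (x::real). of_rat q * x"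
    by (rule vector_space_rat_real)
  have sub: "real_subfield K" and dim: "Q.dim K = 2"
    using assms by (auto simp: real_quadratic_field_def)
  have rat: "\<rat> \<subseteq> K" by (rule Rats_subset_real_subfield[OF sub])
  have K: "\<And>x y. x \<in> K \<Longrightarrow> y \<in> K \<Longrightarrow> x + y \<in> K" "\<And>x y. x \<in> K \<Longrightarrow> y \<in> K \<Longrightarrow> x * y \<in> K"
    using sub by (auto simp: real_subfield_def)
  obtain B where B: "{1} \<subseteq> B" "B \<subseteq> K" "Q.independent B" "K \<subseteq> Q.span B"
    by (rule Q.maximal_independent_subset_extend[of "{1}" K]) (use rat in auto)
  have "card B = 2" using Q.basis_card_eq_dim[OF B(2,4,3)] dim by simp
  then obtain w where w: "B = {1, w}" "w \<noteq> 1"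
    using B(1) by (auto simp: card_2_iff)
  have wirr: "w \<notin> \<rat>"
  proof
    assume "w \<in> \<rat>"
    then have "w \<in> Q.span {1}" by (auto simp: Q.span_singleton elim!: Rats_cases)
    then show False using B(3) w Q.independent_insert[of w "{1}"] by (simp add: insert_commute)
  qed
  have KE: "\<exists>a\<in>\<rat>. \<exists>b\<in>\<rat>. x = a + b * w" if "x \<in> K" for x
  proof -
    have "x \<in> Q.span {1, w}" using that B w by auto
    then obtain p q where "x - of_rat p * 1 = of_rat q * w"
      by (auto simp: Q.span_insert Q.span_singleton)
    then have "x = of_rat p + of_rat q * w" by (simp add: algebra_simps)
    then show ?thesis using Rats_of_rat by blast
  qed
  have wK: "w \<in> K" using B w by auto
  from KE[OF K(2)[OF wK wK]] obtain p q where pq: "p \<in> \<rat>" "q \<in> \<rat>" "w * w = p + q * w" by blast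
  define v where "v = w - q / 2"
  have v2: "v\<^sup>2 = p + q\<^sup>2 / 4"
    using pq(3) by (simp add: v_def power2_eq_square algebra_simps)
  have virr: "v \<notin> \<rat>"
  proof
    assume "v \<in> \<rat>"
    then have "v + q / 2 \<in> \<rat>" using pq by auto
    then show False using wirr by (simp add: v_def)
  qed
  then have "v \<noteq> 0" by auto
  have "v\<^sup>2 \<in> \<rat>" unfolding v2 using pq by auto
  then obtain a b where ab: "v\<^sup>2 = of_int a / of_int b" "b > 0" by (auto elim!: Rats_cases')
  have "of_int a / of_int b > (0::real)" using \<open>v \<noteq> 0\<close> ab(1) by (metis zero_less_power2)
  then have "a > 0" using ab(2) by (simp add: zero_less_divide_iff)
  define D where "D = nat (a * b)"
  have D: "real D = of_int (a * b)" using \<open>a > 0\<close> ab by (simp add: D_def)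
  have "(of_int b * v)\<^sup>2 = real D"
    using ab by (simp add: power_mult_distrib D) (simp add: power2_eq_square)
  then have sD: "sqrt (real D) = \<bar>of_int b * v\<bar>" by (metis real_sqrt_abs)
  have sirr: "sqrt (real D) \<notin> \<rat>"
  proof
    assume "sqrt (real D) \<in> \<rat>"
    then have "of_int b * v \<in> \<rat>" by (simp add: sD Rats_abs_iff)
    then have "of_int b * v / of_int b \<in> \<rat>" by (rule Rats_divide) simp
    then show False using virr ab by simp
  qed
  then interpret sqrt_field D by unfold_locales
  \<comment> \<open>The square root is \<open>\<bar>b * v\<bar>\<close>, so the sign of
    \<open>b * v\<close> decides between \<open>1 / b\<close> and \<open>- 1 / b\<close>.\<close>
  obtain c where c: "c \<in> \<rat>" "w = q / 2 + c * s"
  proof (cases "of_int b * v \<ge> 0")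
    case True
    then have "w = q / 2 + (1 / of_int b) * s" using ab by (simp add: sD v_def)
    then show ?thesis by (intro that[of "1 / of_int b"]) auto
  next
    case False
    then have "w = q / 2 + (- 1 / of_int b) * s" using ab by (simp add: sD v_def)
    then show ?thesis by (intro that[of "- 1 / of_int b"]) auto
  qed
  have wF: "w \<in> F" unfolding c using c pq by (intro FI) auto
  have "K = F"
  proof (intro equalityI subsetI)
    fix x assume "x \<in> K"
    then show "x \<in> F" unfolding F_eq_rational_span[OF wF wirr] using KE by blast
  next
    fix x assume "x \<in> F"
    then obtain a b where "a \<in> \<rat>" "b \<in> \<rat>" "x = a + b * w"
      unfolding F_eq_rational_span[OF wF wirr] by blast
    then show "x \<in> K" using rat K wK by (metis subsetD)
  qed
  then show ?thesis using that sqrt_field_axioms by blast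
qed

section \<open>Lucas sequences and the conic\<close>

definition lucas_quot :: "real \<Rightarrow> nat \<Rightarrow> real" where
  "lucas_quot x m = (x ^ m - inverse (x ^ m)) / (x - inverse x)"

lemma inverse_less_self: "1 < (x::real) \<Longrightarrow> inverse x < x"
  using inverse_less_1_iff[of x] by linarith

lemma lucas_quot_0 [simp]: "lucas_quot x 0 = 0"
  by (simp add: lucas_quot_def)

lemma lucas_quot_1 [simp]: "1 < x \<Longrightarrow> lucas_quot x (Suc 0) = 1"
  using inverse_less_self[of x] by (simp add: lucas_quot_def)

text \<open>The product of \<open>x + inverse x\<close> with the numerator at \<open>Suc m\<close>
  is the sum of the numerators at \<open>m\<close> and \<open>Suc (Suc m)\<close>. So
  \<open>lucas_quot\<close> is the closed form of the Lucas sequence with parameters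
  \<open>x + inverse x\<close> and 1.\<close>

lemma lucas_quot_rec:
  assumes "1 < x"
  shows "lucas_quot x (Suc (Suc m)) = (x + inverse x) * lucas_quot x (Suc m) - lucas_quot x m"
proof -
  have "x ^ Suc (Suc m) - inverse (x ^ Suc (Suc m))
      = (x + inverse x) * (x ^ Suc m - inverse (x ^ Suc m)) - (x ^ m - inverse (x ^ m))"
    using assms by (simp add: field_simps)
  then show ?thesis
    unfolding lucas_quot_def by (simp only: diff_divide_distrib[symmetric] times_divide_eq_right)
qed

text \<open>The form \<open>u\<^sup>2 + r\<^sup>2 - t * r * u\<close> is preserved by
  \<open>(r, u) \<mapsto> (u, t * u - r)\<close>, the step of the recurrence, and equals 1 at
  \<open>(0, 1)\<close>.\<close>

lemma lucas_quot_invariant: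
  assumes "1 < x"
  shows "(lucas_quot x (Suc m))\<^sup>2 + (lucas_quot x m)\<^sup>2
           - (x + inverse x) * lucas_quot x m * lucas_quot x (Suc m) = 1"
proof (induction m)
  case 0
  show ?case using assms by simp
next
  case (Suc m)
  then show ?case unfolding lucas_quot_rec[OF assms] by (simp add: power2_eq_square algebra_simps)
qed

lemma add_inverse_gt_2: "1 < (x::real) \<Longrightarrow> 2 < x + inverse x"
proof -
  assume x: "1 < x"
  then have "0 < (x - 1)\<^sup>2 / x" by simp
  also have "(x - 1)\<^sup>2 / x = x + inverse x - 2" using x by (simp add: field_simps power2_eq_square)
  finally show ?thesis by simp
qed

text \<open>As \<open>t > 2\<close>, each difference exceeds the preceding one by
  \<open>(t - 2)\<close> times a positive term. The first difference is exactly 1, hence strictness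
  only for \<open>m > 0\<close>; the strict form is the bound
  \<open>r < (d - 1) / 2\<close>.\<close>

lemma lucas_quot_diff:
  assumes "1 < x"
  shows "lucas_quot x m \<ge> 0 \<and> lucas_quot x (Suc m) \<ge> lucas_quot x m + 1
    \<and> (m > 0 \<longrightarrow> lucas_quot x (Suc m) > lucas_quot x m + 1)"
proof (induction m)
  case 0
  show ?case using assms by simp
next
  case (Suc m)
  define t where "t = x + inverse x"
  have "(t - 2) * lucas_quot x (Suc m) > 0"
    using Suc add_inverse_gt_2[OF assms] by (intro mult_pos_pos) (auto simp: t_def)
  moreover have "lucas_quot x (Suc (Suc m)) - lucas_quot x (Suc m)
      = (t - 2) * lucas_quot x (Suc m) + (lucas_quot x (Suc m) - lucas_quot x m)"
    unfolding lucas_quot_rec[OF assms] t_def by (simp add: algebra_simps)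
  ultimately show ?case using Suc by linarith
qed

lemma lucas_quot_inj: assumes "1 < x" "lucas_quot x m = lucas_quot x m'" shows "m = m'"
proof -
  have "strict_mono (lucas_quot x)"
  proof (rule strict_monoI_Suc)
    fix n show "lucas_quot x n < lucas_quot x (Suc n)"
      using lucas_quot_diff[OF assms(1), of n] by linarith
  qed
  then show ?thesis using assms(2) by (simp add: strict_mono_eq)
qed

text \<open>Vieta descent: for fixed \<open>r\<close> the equation is quadratic in \<open>u\<close>,
  with second root \<open>q = t * r - u\<close>. The pair \<open>(q, r)\<close> is again a solution,
  with smaller first entry, and the recurrence leads back from it.\<close>

lemma conic_solution_lucas_quot:
  fixes r u t :: int
  assumes x: "1 < x" "x + inverse x = of_int t"
    and "0 \<le> r" "r < u" "r\<^sup>2 + u\<^sup>2 - t * r * u = 1"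
  shows "\<exists>m. of_int r = lucas_quot x m \<and> of_int u = lucas_quot x (Suc m)"
  using assms(3-)
proof (induction "nat r" arbitrary: r u rule: less_induct)
  case less
  show ?case
  proof (cases "r = 0")
    case True
    then have "u = 1" using less.prems by (simp add: power2_eq_1_iff)
    then show ?thesis using True x by (intro exI[of _ 0]) simp
  next
    case False
    define q where "q = t * r - u"
    have r: "r > 0" "u > 0" using less.prems False by auto
    \<comment> \<open>The product of the two roots is the constant term; its sign gives
      \<open>q \<ge> 0\<close>, and comparison with \<open>r * r\<close> gives
      \<open>q < r\<close>.\<close>
    have uq: "u * q = r\<^sup>2 - 1" using less.prems by (simp add: q_def algebra_simps power2_eq_square)
    have "r\<^sup>2 \<ge> 1" using r by (simp add: int_one_le_iff_zero_less)
    then have "u * q \<ge> 0" unfolding uq by linarith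
    then have q0: "q \<ge> 0" using r by (simp add: zero_le_mult_iff)
    have qr: "q < r"
    proof (rule ccontr)
      assume "\<not> q < r"
      then have "u * q \<ge> r * r" using r less.prems by (intro mult_mono) auto
      then show False using uq by (simp add: power2_eq_square)
    qed
    have "q\<^sup>2 + r\<^sup>2 - t * q * r = 1"
      using less.prems(3) by (simp add: q_def algebra_simps power2_eq_square)
    from less.hyps[OF _ q0 qr this] obtain m
      where m: "of_int q = lucas_quot x m" "of_int r = lucas_quot x (Suc m)"
      using q0 qr by auto
    have "of_int u = lucas_quot x (Suc (Suc m))"
      unfolding lucas_quot_rec[OF x(1)] m[symmetric] x(2) by (simp add: q_def)
    with m show ?thesis by blast
  qed
qed

section \<open>The grids of a real quadratic field\<close>

lemma real_quadratic_field_unit: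
  assumes "real_quadratic_field K"
  shows "1 < norm_one_unit K" "rank_grid K j m = lucas_quot (norm_one_unit K ^ j) m"
proof -
  obtain D where D: "sqrt_field D" "K = sqrt_field.F D" using real_quadratic_field_eq_F[OF assms] .
  interpret sqrt_field D by (rule D(1))
  show "1 < norm_one_unit K" using eps_gt_1 D by simp
  \<comment> \<open>The nonzero \<open>sqrt (field_disc K)\<close> cancels, and
    \<open>eps ^ (j * m) = (eps ^ j) ^ m\<close>.\<close>
  show "rank_grid K j m = lucas_quot (norm_one_unit K ^ j) m"
    using field_disc_nonzero by (simp add: D(2) rank_grid_def f_seq_def lucas_quot_def power_mult)
qed

text \<open>The first two positive terms of the Lucas sequence are 1 and
  \<open>t = x + inverse x\<close>, with sum \<open>t + 1\<close>. So
  \<open>n = dim_seq K j + 1\<close> means \<open>t = n - 2\<close>.\<close>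

lemma dim_seq_eq:
  assumes "real_quadratic_field K" "j > 0"
  shows "dim_seq K j = norm_one_unit K ^ j + inverse (norm_one_unit K ^ j) + 1"
proof -
  have "norm_one_unit K ^ j > 1" using real_quadratic_field_unit[OF assms(1)] assms(2) by simp
  then show ?thesis
    by (simp add: dim_seq_def dim_grid_def real_quadratic_field_unit[OF assms(1)] lucas_quot_rec)
qed

lemma rank_grid_bounds_and_identity:
  assumes "real_quadratic_field K" "j > 0" "m > 0"
  shows "0 < rank_grid K j m" "rank_grid K j m < (dim_grid K j m - 1) / 2"
    "(dim_seq K j + 1) * rank_grid K j m * (dim_grid K j m - rank_grid K j m) = (dim_grid K j m)\<^sup>2 - 1"
proof -
  define x where "x = norm_one_unit K ^ j"
  have x: "x > 1" using real_quadratic_field_unit[OF assms(1)] assms(2) by (simp add: x_def)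
  have R: "rank_grid K j n = lucas_quot x n" for n
    by (simp add: x_def real_quadratic_field_unit[OF assms(1)])
  have d: "dim_grid K j m = lucas_quot x (Suc m) + lucas_quot x m" by (simp add: dim_grid_def R)
  obtain k where k: "m = Suc k" using assms(3) by (cases m) auto
  show "0 < rank_grid K j m" using lucas_quot_diff[OF x, of k] by (simp add: R k)
  show "rank_grid K j m < (dim_grid K j m - 1) / 2"
    using lucas_quot_diff[OF x, of m] assms(3) by (simp add: R d)
  \<comment> \<open>With \<open>u = d - r\<close> the claim is
    \<open>(t + 2) * r * u = (r + u)\<^sup>2 - 1\<close>, the invariant rearranged.\<close>
  show "(dim_seq K j + 1) * rank_grid K j m * (dim_grid K j m - rank_grid K j m) = (dim_grid K j m)\<^sup>2 - 1"
    using lucas_quot_invariant[OF x, of m] unfolding R d dim_seq_eq[OF assms(1,2)] x_def[symmetric]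
    by (simp add: power2_eq_square algebra_simps)
qed

section \<open>The converse: recovering the field and the indices\<close>

lemma sqrt_sq_minus_4_irrational:
  fixes t :: int
  assumes "t \<ge> 3" shows "sqrt (of_int (t\<^sup>2 - 4)) \<notin> \<rat>"
proof
  have ge: "t\<^sup>2 \<ge> 9" using power_mono[of 3 t 2] assms by simp
  define z where "z = sqrt (of_int (t\<^sup>2 - 4))"
  have z2: "z\<^sup>2 = of_int (t\<^sup>2 - 4)" unfolding z_def using ge by (intro real_sqrt_pow2) linarith
  assume "sqrt (of_int (t\<^sup>2 - 4)) \<in> \<rat>"
  moreover have "algebraic_int z"
    by (rule algebraic_int_monic_quadratic[of 0 "- of_int (t\<^sup>2 - 4)"]) (auto simp: z2)
  ultimately have "z \<in> \<int>" using rational_algebraic_int_is_int z_def by blast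
  then obtain a where a: "z = of_int a" by (auto simp: Ints_def)
  have "z \<ge> 0" unfolding z_def using ge by (intro real_sqrt_ge_zero) linarith
  then have a0: "a \<ge> 0" using a by simp
  have eq: "a\<^sup>2 = t\<^sup>2 - 4" using z2 unfolding a by (metis of_int_eq_iff of_int_power)
  \<comment> \<open>For \<open>t \<ge> 3\<close> the number \<open>t\<^sup>2 - 4\<close> lies
    strictly between the consecutive squares of \<open>t - 1\<close> and \<open>t\<close>.\<close>
  have "a < t" using eq assms a0 by (intro power_less_imp_less_base[of a 2 t]) auto
  moreover have "t - 1 < a"
  proof (rule power_less_imp_less_base[of _ 2])
    show "(t - 1)\<^sup>2 < a\<^sup>2" unfolding eq using assms by (simp add: power2_eq_square algebra_simps)
  qed (use a0 in auto)
  ultimately show False by simp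
qed

lemma add_inverse_inj:
  fixes x y :: real
  assumes "1 < x" "1 < y" "x + inverse x = y + inverse y" shows "x = y"
  using add_inverse_strict_mono[of x y] add_inverse_strict_mono[of y x] assms
  by (metis less_irrefl linorder_neqE_linordered_idom)

text \<open>A norm 1 unit above 1 is irrational, hence generates the field. The right side depends
  only on the number \<open>norm_one_unit K ^ j\<close>, so two fields that share such a number are
  equal.\<close>

lemma real_quadratic_field_eq_span_unit_power:
  assumes "real_quadratic_field K" "j > 0"
  shows "K = {a + b * norm_one_unit K ^ j |a b. a \<in> \<rat> \<and> b \<in> \<rat>}"
proof -
  obtain D where D: "sqrt_field D" "K = sqrt_field.F D" using real_quadratic_field_eq_F[OF assms(1)] .
  interpret sqrt_field D by (rule D(1))
  have unit: "eps ^ j \<in> norm_one_units" using norm_one_units_power eps_least assms(2) by blast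
  then have "eps ^ j \<in> F" using int_F_D(1) by (simp add: norm_one_units_def)
  then show "K = {a + b * norm_one_unit K ^ j |a b. a \<in> \<rat> \<and> b \<in> \<rat>}"
    unfolding D(2) using norm_one_units_irrational[OF unit] by (rule F_eq_rational_span)
qed

text \<open>The larger root \<open>(t + sqrt (t\<^sup>2 - 4)) / 2\<close> of
  \<open>X\<^sup>2 - t * X + 1\<close> is an integer of norm 1 above 1 in the field of
  \<open>sqrt (t\<^sup>2 - 4)\<close>, hence a power of its fundamental unit.\<close>

lemma power_unit_with_trace:
  fixes t :: int
  assumes "t \<ge> 3"
  obtains K j where "real_quadratic_field K" "j > 0"
    "norm_one_unit K ^ j + inverse (norm_one_unit K ^ j) = of_int t"
proof -
  define D where "D = nat (t\<^sup>2 - 4)"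
  have ge: "t\<^sup>2 \<ge> 9" using power_mono[of 3 t 2] assms by simp
  have D: "real D = of_int (t\<^sup>2 - 4)" using ge by (simp add: D_def)
  interpret sqrt_field D
    by unfold_locales (use sqrt_sq_minus_4_irrational[OF assms] D in simp)
  define x where "x = of_int t / 2 + (1 / 2) * s"
  have cj: "cj x = of_int t / 2 - (1 / 2) * s" unfolding x_def by (intro cj_eq) auto
  have sum: "x + cj x = of_int t" unfolding cj by (simp add: x_def)
  have prod: "x * cj x = 1"
  proof -
    have "x * cj x = ((of_int t)\<^sup>2 - s\<^sup>2) / 4"
      unfolding cj by (simp add: x_def field_simps power2_eq_square)
    also have "s\<^sup>2 = of_int (t\<^sup>2 - 4)" using D by simp
    finally show ?thesis by simp
  qed
  have "x \<in> F" unfolding x_def by (intro FI) auto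
  then have "x \<in> int_F" by (simp add: ring_of_integers_F sum prod)
  moreover have "x > 1"
  proof -
    have "of_int t \<ge> (3::real)" using assms by simp
    moreover have "s \<ge> 0" by simp
    ultimately show ?thesis unfolding x_def by linarith
  qed
  ultimately have unit: "x \<in> norm_one_units" by (simp add: norm_one_units_def prod)
  then obtain j where j: "j > 0" "x = eps ^ j" using norm_one_units_eps_power by blast
  show thesis
    using that[OF real_quadratic_field_F j(1)] sum norm_one_units_cj[OF unit] j(2) by simp
qed

theorem theorem4p20:
  shows "(\<forall>K. real_quadratic_field K \<longrightarrow>
            (\<forall>j m :: nat. 0 < j \<and> 0 < m \<longrightarrow>
               (0 < rank_grid K j m \<and> rank_grid K j m < (dim_grid K j m - 1) / 2) \<and>
               (dim_seq K j + 1) * rank_grid K j m * (dim_grid K j m - rank_grid K j m)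
                 = (dim_grid K j m)\<^sup>2 - 1))
       \<and> (\<forall>r d n :: int.
            0 < r \<and> real_of_int r < (real_of_int d - 1) / 2 \<and> n > 4 \<and>
            n * r * (d - r) = d\<^sup>2 - 1 \<longrightarrow>
            (\<exists>!(K, j, m). real_quadratic_field K \<and> 0 < j \<and> 0 < m \<and>
               real_of_int r = rank_grid K j m \<and> real_of_int d = dim_grid K j m \<and>
               real_of_int n = dim_seq K j + 1))"
proof (rule conjI; intro allI impI)
  fix K and j m :: nat
  assume K: "real_quadratic_field K" and jm: "0 < j \<and> 0 < m"
  show "(0 < rank_grid K j m \<and> rank_grid K j m < (dim_grid K j m - 1) / 2) \<and>
    (dim_seq K j + 1) * rank_grid K j m * (dim_grid K j m - rank_grid K j m) = (dim_grid K j m)\<^sup>2 - 1"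
    using rank_grid_bounds_and_identity[OF K, of j m] jm by simp
next
  fix r d n :: int
  assume "0 < r \<and> real_of_int r < (real_of_int d - 1) / 2 \<and> n > 4 \<and> n * r * (d - r) = d\<^sup>2 - 1"
  then have r: "0 < r" "real_of_int r < (real_of_int d - 1) / 2" and n: "n > 4"
    and eq: "n * r * (d - r) = d\<^sup>2 - 1" by blast+
  \<comment> \<open>This is forced by \<open>n = t + 2\<close>; the hypothesis \<open>n > 4\<close>
    becomes \<open>t \<ge> 3\<close>, where \<open>t\<^sup>2 - 4\<close> is a positive
    nonsquare.\<close>
  define t where "t = n - 2"
  have t: "t \<ge> 3" using n by (simp add: t_def)
  have lt: "r < d - r" using r(2) by simp
  have conic: "r\<^sup>2 + (d - r)\<^sup>2 - t * r * (d - r) = 1"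
    using eq by (simp add: t_def power2_eq_square algebra_simps)
  obtain K j where K: "real_quadratic_field K" and j: "j > 0"
    and tr: "norm_one_unit K ^ j + inverse (norm_one_unit K ^ j) = of_int t"
    by (rule power_unit_with_trace[OF t])
  have x1: "norm_one_unit K ^ j > 1" using real_quadratic_field_unit(1)[OF K] j by simp
  obtain m where m: "of_int r = lucas_quot (norm_one_unit K ^ j) m"
    "of_int (d - r) = lucas_quot (norm_one_unit K ^ j) (Suc m)"
    using conic_solution_lucas_quot[OF x1 tr _ lt conic] r(1) by auto
  have m0: "m > 0" using m(1) r(1) by (cases "m = 0") auto
  have nn: "real_of_int n = dim_seq K j + 1"
    using tr by (simp add: dim_seq_eq[OF K j] t_def)
  have rr: "real_of_int r = rank_grid K j m" by (simp add: m real_quadratic_field_unit(2)[OF K])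
  have dd: "real_of_int d = dim_grid K j m"
    using m by (simp add: dim_grid_def real_quadratic_field_unit(2)[OF K])
  show "\<exists>!(K, j, m). real_quadratic_field K \<and> 0 < j \<and> 0 < m \<and>
               real_of_int r = rank_grid K j m \<and> real_of_int d = dim_grid K j m \<and>
               real_of_int n = dim_seq K j + 1"
  proof (rule ex1I[of _ "(K, j, m)"])
    fix z :: "real set \<times> nat \<times> nat"
    obtain K' j' m' where z: "z = (K', j', m')" by (cases z) auto
    assume "case z of (K, j, m) \<Rightarrow> real_quadratic_field K \<and> 0 < j \<and> 0 < m \<and>
               real_of_int r = rank_grid K j m \<and> real_of_int d = dim_grid K j m \<and>
               real_of_int n = dim_seq K j + 1"
    then have K': "real_quadratic_field K'" and j': "j' > 0" and r': "real_of_int r = rank_grid K' j' m'"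
      and n': "real_of_int n = dim_seq K' j' + 1" by (auto simp: z)
    have x1': "norm_one_unit K' ^ j' > 1" using real_quadratic_field_unit(1)[OF K'] j' by simp
    \<comment> \<open>Uniqueness: \<open>n\<close> gives the trace of the unit power and hence the
      power itself; that number gives the field, then \<open>j\<close> because powers of a number
      above 1 are distinct, and \<open>r\<close> gives \<open>m\<close>.\<close>
    have xx: "norm_one_unit K' ^ j' = norm_one_unit K ^ j"
    proof (rule add_inverse_inj[OF x1' x1])
      show "norm_one_unit K' ^ j' + inverse (norm_one_unit K' ^ j')
          = norm_one_unit K ^ j + inverse (norm_one_unit K ^ j)"
        using n' nn unfolding dim_seq_eq[OF K j] dim_seq_eq[OF K' j'] by linarith
    qed
    have "K' = {a + b * norm_one_unit K' ^ j' |a b. a \<in> \<rat> \<and> b \<in> \<rat>}"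
      by (rule real_quadratic_field_eq_span_unit_power[OF K' j'])
    also have "\<dots> = K"
      unfolding xx by (rule real_quadratic_field_eq_span_unit_power[OF K j, symmetric])
    finally have KK: "K' = K" .
    have jj: "j' = j"
      using xx real_quadratic_field_unit(1)[OF K] by (simp add: KK)
    have "m' = m"
      using r' rr by (intro lucas_quot_inj[OF x1]) (simp add: KK jj real_quadratic_field_unit(2)[OF K])
    then show "z = (K, j, m)" by (simp add: z KK jj)
  qed (use K j m0 rr dd nn in simp)
qed

end
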